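(* There is no polynomial-time algorithm for computing an optimal (i.e., $0$-best) solution of the nonlinear optimization problem $\min\{f(wx) : x\in S\}$ over an independence system $S\subseteq\{0,1\}^n$ presented by a linear-optimization oracle, with $f:\mathbb{Z}\rightarrow\mathbb{R}$ presented by a comparison oracle and weight vector $w\in\{2,3\}^n$.
   Context: An independence system is a nonempty set $S\subseteq\{0,1\}^n$ such that $x\in\{0,1\}^n$ and $x\le y\in S$ (componentwise) imply $x\in S$. For $v\in\mathbb{Z}^n$ and $x\in\{0,1\}^n$, $vx:=\sum_{j=1}^n v_jx_j$. A linear-optimization oracle for $S$, queried on $v\in\mathbb{Z}^n$, returns an element $x\in S$ maximizing $vx$ over $S$. A comparison oracle for $f$, queried on $x,y\in\mathbb{Z}$, asserts whether or not $f(x)\le f(y)$. The algorithm accesses $S$ and $f$ only through these oracles, and running time is measured in the usual oracle model, each oracle query counting as one step. A $0$-best (optimal) solution is a point $x^*\in S$ such that $f(wx^* )\le f(wx)$ for all $x\in S$. *)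

theory Defs
  imports Complex_Main "HOL-Computational_Algebra.Polynomial"
begin

section \<open>Independence systems, oracles and optimal solutions\<close>

text \<open>A vector with \<open>n\<close> components is a list of length \<open>n\<close>, so that \<open>n\<close> can be quantified.\<close>

definition bin_vecs :: "nat \<Rightarrow> int list set" where
  "bin_vecs n = {x. length x = n \<and> set x \<subseteq> {0, 1}}"

definition dot :: "int list \<Rightarrow> int list \<Rightarrow> int" where
  "dot v x = (\<Sum>j<length x. v ! j * x ! j)"

definition independence_system :: "nat \<Rightarrow> int list set \<Rightarrow> bool" where
  "independence_system n S \<longleftrightarrow>
     S \<subseteq> bin_vecs n \<and> S \<noteq> {} \<and>
     (\<forall>x\<in>bin_vecs n. \<forall>y\<in>S. list_all2 (\<le>) x y \<longrightarrow> x \<in> S)"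

text \<open>An oracle is a function of the query. Where the maximizer is not unique, the function
  chooses one arbitrarily.\<close>

definition linear_optimization_oracle ::
    "nat \<Rightarrow> int list set \<Rightarrow> (int list \<Rightarrow> int list) \<Rightarrow> bool" where
  "linear_optimization_oracle n S lin \<longleftrightarrow>
     (\<forall>v. length v = n \<longrightarrow> lin v \<in> S \<and> (\<forall>x\<in>S. dot v x \<le> dot v (lin v)))"

definition comparison_oracle :: "(int \<Rightarrow> real) \<Rightarrow> (int \<Rightarrow> int \<Rightarrow> bool) \<Rightarrow> bool" where
  "comparison_oracle f cmp \<longleftrightarrow> (\<forall>a b. cmp a b \<longleftrightarrow> f a \<le> f b)"

definition optimal_solution ::
    "int list set \<Rightarrow> (int \<Rightarrow> real) \<Rightarrow> int list \<Rightarrow> int list \<Rightarrow> bool" where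
  "optimal_solution S f w x \<longleftrightarrow> x \<in> S \<and> (\<forall>y\<in>S. f (dot w x) \<le> f (dot w y))"

section \<open>Encoding of integer vectors as words\<close>

text \<open>\<open>Aux\<close> symbols let a machine use any finite tape alphabet that contains the other symbols;
  finiteness is imposed in \<open>well_formed\<close>.\<close>

datatype sym = Blank | Bit bool | Minus | Sep | Aux nat

text \<open>Binary notation, most significant digit first.\<close>

fun binary :: "nat \<Rightarrow> bool list" where
  "binary m = (if m < 2 then [odd m] else binary (m div 2) @ [odd m])"

declare binary.simps [simp del]

definition enc_int :: "int \<Rightarrow> sym list" where
  "enc_int z = (if z < 0 then [Minus] else []) @ map Bit (binary (nat \<bar>z\<bar>))"

definition enc_vec :: "int list \<Rightarrow> sym list" where
  "enc_vec v = concat (map (\<lambda>z. enc_int z @ [Sep]) v)"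

lemma horner_sum_binary: "horner_sum of_bool 2 (rev (binary m)) = m"
proof (induction m rule: binary.induct)
  case (1 m)
  then show ?case
    by (subst binary.simps) (auto simp: less_2_cases_iff)
qed

lemma inj_enc_int: "inj enc_int"
proof (rule injI)
  fix y z :: int
  assume eq: "enc_int y = enc_int z"
  have ne: "binary m \<noteq> []" for m
    by (subst binary.simps) simp
  have bits: "nat \<bar>y\<bar> = nat \<bar>z\<bar>" if "binary (nat \<bar>y\<bar>) = binary (nat \<bar>z\<bar>)"
    using that horner_sum_binary by metis
  have "inj Bit" by (simp add: inj_def)
  with eq have "binary (nat \<bar>y\<bar>) = binary (nat \<bar>z\<bar>) \<and> (y < 0 \<longleftrightarrow> z < 0)"
    using ne[of "nat \<bar>y\<bar>"] ne[of "nat \<bar>z\<bar>"]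
    by (cases "binary (nat \<bar>y\<bar>)"; cases "binary (nat \<bar>z\<bar>)")
       (auto simp: enc_int_def inj_map_eq_map split: if_splits)
  with bits show "y = z" by linarith
qed

lemma separated:
  assumes "xs @ s # us = ys @ s # vs" "s \<notin> set xs" "s \<notin> set ys"
  shows "xs = ys \<and> us = vs"
  using assms
proof (induction xs arbitrary: ys)
  case Nil
  then show ?case by (cases ys) auto
next
  case (Cons x xs)
  then show ?case by (cases ys) auto
qed

lemma inj_enc_vec: "inj enc_vec"
proof (rule injI)
  fix u v :: "int list"
  assume "enc_vec u = enc_vec v"
  moreover have sep: "Sep \<notin> set (enc_int z)" for z
    by (auto simp: enc_int_def)
  ultimately show "u = v"
  proof (induction u arbitrary: v)
    case Nil
    then show ?case by (cases v) (auto simp: enc_vec_def)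
  next
    case (Cons a u)
    then obtain b v' where v: "v = b # v'"
      by (cases v) (auto simp: enc_vec_def)
    have "enc_int a @ Sep # enc_vec u = enc_int b @ Sep # enc_vec v'"
      using Cons.prems(1) by (simp add: v enc_vec_def)
    then have "enc_int a = enc_int b \<and> enc_vec u = enc_vec v'"
      using sep[of a] sep[of b] by (rule separated)
    then show ?case
      using Cons.IH[of v'] sep inj_enc_int by (auto simp: v inj_def)
  qed
qed

section \<open>Oracle Turing machines\<close>

text \<open>Deterministic multitape Turing machines with two-way infinite tapes. A tape \<open>(l, r)\<close> carries
  \<open>rev l @ r\<close>, surrounded by blanks, and its head is on the first symbol of \<open>r\<close>.\<close>

type_synonym tape = "sym list \<times> sym list"

datatype dir = Go_left | Stay | Go_right

definition scanned :: "tape \<Rightarrow> sym" where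
  "scanned t = (case snd t of [] \<Rightarrow> Blank | s # _ \<Rightarrow> s)"

fun act :: "sym \<times> dir \<Rightarrow> tape \<Rightarrow> tape" where
  "act (s, Stay) (l, r) = (l, s # tl r)"
| "act (s, Go_right) (l, r) = (s # l, tl r)"
| "act (s, Go_left) ([], r) = ([], Blank # s # tl r)"
| "act (s, Go_left) (c # l, r) = (l, c # s # tl r)"

definition word_at_head :: "tape \<Rightarrow> sym list" where
  "word_at_head t = takeWhile (\<lambda>s. s \<noteq> Blank) (snd t)"

text \<open>The states of a machine are the positions in its program, with initial state \<open>0\<close>. The
  instruction at a state says what happens there: an ordinary transition, which maps the scanned
  symbols to the next state and to one action per tape, an oracle query together with the state in
  which the machine resumes, or halting.\<close>

datatype instr =
    Halt
  | Move "sym list \<Rightarrow> nat \<times> (sym \<times> dir) list"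
  | Query_lin nat
  | Query_cmp nat

record oracle_machine =
  num_tapes :: nat
  program :: "instr list"

definition well_formed :: "oracle_machine \<Rightarrow> bool" where
  "well_formed M \<longleftrightarrow>
     2 \<le> num_tapes M \<and> program M \<noteq> [] \<and>
     (\<exists>\<Gamma>. finite \<Gamma> \<and> {Blank, Bit False, Bit True, Minus, Sep} \<subseteq> \<Gamma> \<and>
       (\<forall>i\<in>set (program M). case i of
          Halt \<Rightarrow> True
        | Query_lin q \<Rightarrow> q < length (program M)
        | Query_cmp q \<Rightarrow> q < length (program M)
        | Move \<delta> \<Rightarrow>
            (\<forall>ss. length ss = num_tapes M \<and> set ss \<subseteq> \<Gamma> \<longrightarrow>
              (case \<delta> ss of (q, as) \<Rightarrow>
                 q < length (program M) \<and> length as = num_tapes M \<and> fst ` set as \<subseteq> \<Gamma>))))"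

text \<open>Tape \<open>0\<close> carries the input and the output, and tape \<open>1\<close> is the oracle tape. In a single step
  an oracle reads the query at the head of the oracle tape and replaces the contents of that tape by
  its answer. Words that do not encode a query are answered by the empty word.\<close>

definition lin_answer :: "nat \<Rightarrow> (int list \<Rightarrow> int list) \<Rightarrow> sym list \<Rightarrow> sym list" where
  "lin_answer n lin u =
     (if \<exists>v. length v = n \<and> u = enc_vec v then enc_vec (lin (THE v. u = enc_vec v)) else [])"

definition cmp_answer :: "(int \<Rightarrow> int \<Rightarrow> bool) \<Rightarrow> sym list \<Rightarrow> sym list" where
  "cmp_answer cmp u =
     (if \<exists>a b. u = enc_vec [a, b]
      then [Bit (case THE (a, b). u = enc_vec [a, b] of (a, b) \<Rightarrow> cmp a b)] else [])"

lemma lin_answer_enc_vec: "length v = n \<Longrightarrow> lin_answer n lin (enc_vec v) = enc_vec (lin v)"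
  using inj_enc_vec by (auto simp: lin_answer_def inj_eq)

lemma cmp_answer_enc_vec: "cmp_answer cmp (enc_vec [a, b]) = [Bit (cmp a b)]"
  using inj_enc_vec by (auto simp: cmp_answer_def inj_eq)

type_synonym config = "nat \<times> tape list"

definition initial_config :: "oracle_machine \<Rightarrow> sym list \<Rightarrow> config" where
  "initial_config M u = (0, ([], u) # replicate (num_tapes M - 1) ([], []))"

definition halted :: "oracle_machine \<Rightarrow> config \<Rightarrow> bool" where
  "halted M c \<longleftrightarrow> program M ! fst c = Halt"

definition step ::
    "oracle_machine \<Rightarrow> nat \<Rightarrow> (int list \<Rightarrow> int list) \<Rightarrow> (int \<Rightarrow> int \<Rightarrow> bool) \<Rightarrow> config \<Rightarrow> config" where
  "step M n lin cmp c = (case c of (q, ts) \<Rightarrow>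
     (case program M ! q of
        Halt \<Rightarrow> (q, ts)
      | Move \<delta> \<Rightarrow> (case \<delta> (map scanned ts) of (q', as) \<Rightarrow> (q', map2 act as ts))
      | Query_lin q' \<Rightarrow> (q', ts[1 := ([], lin_answer n lin (word_at_head (ts ! 1)))])
      | Query_cmp q' \<Rightarrow> (q', ts[1 := ([], cmp_answer cmp (word_at_head (ts ! 1)))])))"

definition outputs_within ::
    "oracle_machine \<Rightarrow> nat \<Rightarrow> (int list \<Rightarrow> int list) \<Rightarrow> (int \<Rightarrow> int \<Rightarrow> bool)
      \<Rightarrow> sym list \<Rightarrow> nat \<Rightarrow> sym list \<Rightarrow> bool" where
  "outputs_within M n lin cmp u T y \<longleftrightarrow>
     (\<exists>t\<le>T. let c = (step M n lin cmp ^^ t) (initial_config M u) in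
        halted M c \<and> word_at_head (snd c ! 0) = y)"

end

theory Submission imports Defs begin

text \<open>
  The proof is an adversary argument, and it counts only oracle queries.

  Split the ground set \<open>{..<2 * k}\<close> into a half \<open>I = {..<k}\<close> of weight \<open>2\<close> and a half
  \<open>J = {k..<2 * k}\<close> of weight \<open>3\<close>. The \<^emph>\<open>visible\<close> sets are the subsets of the ground set that have
  at most \<open>a + 1\<close> elements in \<open>I\<close> and \<open>a - 1\<close> in \<open>J\<close>, or at most \<open>a - 1\<close> in \<open>I\<close> and \<open>a + 1\<close> in
  \<open>J\<close>. A set with \<open>a\<close> elements in each half has weight \<open>5 * a\<close>. No visible set has this weight:
  those of the first kind are too light, and those of the second kind are too light or miss it
  by parity (\<open>dot_weights_visible\<close>). Every proper subset of such a set is visible, so adding a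
  single one of them to the visible sets gives an independence system again
  (\<open>independence_system_insert_hidden\<close>). Let \<open>f\<close> be \<open>0\<close> at \<open>5 * a\<close> and \<open>1\<close> elsewhere. The added set is
  then the only optimal solution, whereas without it every visible set is optimal. Since \<open>f\<close> is
  the same in all these instances, comparison queries do not tell them apart.

  Linear-optimization queries give away very little if the \<^emph>\<open>hidden\<close> sets are the unions
  \<open>A \<union> (k + A)\<close> of an \<open>a\<close>-element set \<open>A \<subseteq> I\<close> and its copy in \<open>J\<close>: for each objective \<open>v\<close>, at
  most one hidden set has a larger value than all visible sets. For if \<open>i \<in> A - B\<close> and
  \<open>j \<in> B - A\<close>, then exchanging \<open>i\<close> for \<open>k + j\<close> in the hidden set of \<open>A\<close>, and \<open>k + j\<close> for \<open>i\<close> in that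
  of \<open>B\<close>, leads to visible sets; if both hidden sets beat these, then \<open>v\<close> is larger at \<open>i\<close> than at
  \<open>k + j\<close> and conversely (\<open>at_most_one_hidden_beats_visible\<close>). An oracle that resolves ties in favour
  of visible sets thus reveals at most one hidden set per query
  (\<open>indistinguishable_within\<close>).

  For \<open>k = 2 * a\<close> there are at least \<open>2 ^ a\<close> hidden sets, which for some \<open>a\<close> exceeds the polynomial
  time bound. A run on the visible sets alone then misses some hidden set, and the machine
  behaves in the same way when this set is added. Its output would have to be optimal in
  both instances, which is impossible.
\<close>

section \<open>Subsets as binary vectors\<close>

definition indicator_vec :: "nat \<Rightarrow> nat set \<Rightarrow> int list" where
  "indicator_vec n X = map (\<lambda>j. of_bool (j \<in> X)) [0..<n]"

lemma length_indicator_vec [simp]: "length (indicator_vec n X) = n"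
  by (simp add: indicator_vec_def)

lemma nth_indicator_vec [simp]: "j < n \<Longrightarrow> indicator_vec n X ! j = of_bool (j \<in> X)"
  by (simp add: indicator_vec_def)

lemma indicator_vec_in_bin_vecs: "indicator_vec n X \<in> bin_vecs n"
  by (auto simp: bin_vecs_def indicator_vec_def)

lemma bin_vec_is_indicator_vec:
  assumes "x \<in> bin_vecs n"
  shows "x = indicator_vec n {j. j < n \<and> x ! j = 1}"
proof (rule nth_equalityI)
  show "length x = length (indicator_vec n {j. j < n \<and> x ! j = 1})"
    using assms by (simp add: bin_vecs_def)
next
  fix i assume "i < length x"
  moreover from this have "x ! i \<in> {0, 1}"
    using assms nth_mem[of i x] by (auto simp: bin_vecs_def simp del: nth_mem)
  ultimately show "x ! i = indicator_vec n {j. j < n \<and> x ! j = 1} ! i"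
    using assms by (auto simp: bin_vecs_def)
qed

lemma dot_indicator_vec:
  assumes "X \<subseteq> {..<n}"
  shows "dot v (indicator_vec n X) = (\<Sum>j\<in>X. v ! j)"
proof -
  have "dot v (indicator_vec n X) = (\<Sum>j<n. if j \<in> X then v ! j else 0)"
    unfolding dot_def length_indicator_vec by (rule sum.cong) simp_all
  also have "\<dots> = (\<Sum>j\<in>X. v ! j)"
    using assms sum.inter_restrict[of "{..<n}" "\<lambda>j. v ! j" X] by (simp add: Int_absorb1)
  finally show ?thesis .
qed

lemma independence_system_indicator_vecs:
  assumes "F \<noteq> {}" and "\<And>X Y. X \<subseteq> Y \<Longrightarrow> Y \<in> F \<Longrightarrow> X \<in> F" and "\<And>X. X \<in> F \<Longrightarrow> X \<subseteq> {..<n}"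
  shows "independence_system n (indicator_vec n ` F)"
  unfolding independence_system_def
proof (intro conjI ballI impI)
  show "indicator_vec n ` F \<subseteq> bin_vecs n"
    by (auto intro: indicator_vec_in_bin_vecs)
  show "indicator_vec n ` F \<noteq> {}"
    using assms(1) by simp
next
  fix x y assume x: "x \<in> bin_vecs n" and y: "y \<in> indicator_vec n ` F" and le: "list_all2 (\<le>) x y"
  from y obtain Y where Y: "Y \<in> F" "y = indicator_vec n Y" by blast
  let ?X = "{j. j < n \<and> x ! j = 1}"
  have "?X \<subseteq> Y"
  proof
    fix j assume "j \<in> ?X"
    then have "j < n" "x ! j = 1" by auto
    then have "1 \<le> y ! j"
      using le Y(2) list_all2_nthD2[of "(\<le>)" x y j] by simp
    then show "j \<in> Y"
      using \<open>j < n\<close> Y(2) by (cases "j \<in> Y") auto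
  qed
  then have "?X \<in> F" using assms(2) Y(1) by blast
  then show "x \<in> indicator_vec n ` F"
    using bin_vec_is_indicator_vec[OF x] by blast
qed

lemma finite_bin_vecs: "finite (bin_vecs n)"
  unfolding bin_vecs_def using finite_lists_length_eq[of "{0, 1 :: int}" n]
  by (simp add: conj_commute)

section \<open>Linear-optimization oracles\<close>

lemma ex_linear_optimization_oracle:
  assumes "independence_system n S"
  shows "\<exists>lin. linear_optimization_oracle n S lin"
proof -
  have S: "finite S" "S \<noteq> {}"
    using assms finite_bin_vecs finite_subset by (auto simp: independence_system_def)
  have "\<exists>x\<in>S. \<forall>y\<in>S. dot v y \<le> dot v x" for v
  proof -
    have "Max (dot v ` S) \<in> dot v ` S"
      using S by (intro Max_in) auto
    then obtain x where "x \<in> S" "Max (dot v ` S) = dot v x" by blast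
    then show ?thesis using S(1) by (metis Max_ge finite_imageI imageI)
  qed
  then show ?thesis
    unfolding linear_optimization_oracle_def by metis
qed

text \<open>Ties are resolved in favour of \<open>lin\<close>: the answer changes only for objectives under
  which \<open>e\<close> is strictly better, so that few queries reveal that \<open>e\<close> is feasible.\<close>

definition prefer_old :: "(int list \<Rightarrow> int list) \<Rightarrow> int list \<Rightarrow> int list \<Rightarrow> int list" where
  "prefer_old lin e v = (if dot v e \<le> dot v (lin v) then lin v else e)"

lemma linear_optimization_oracle_insert:
  assumes "linear_optimization_oracle n S lin"
  shows "linear_optimization_oracle n (insert e S) (prefer_old lin e)"
  using assms by (fastforce simp: linear_optimization_oracle_def prefer_old_def)

section \<open>Runs of oracle machines\<close>

lemma halted_stays:
  assumes "halted M c"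
  shows "(step M n lin cmp ^^ t) c = c"
proof (induction t)
  case (Suc t)
  have "step M n lin cmp c = c"
    using assms by (cases c) (simp add: step_def halted_def)
  with Suc show ?case by simp
qed simp

text \<open>A configuration that has halted never changes again, so the step at which the output is read
  is immaterial.\<close>

lemma outputs_within_unique:
  assumes "outputs_within M n lin cmp u T y" "outputs_within M n lin cmp u T' y'"
  shows "y = y'"
proof -
  define c where "c t = (step M n lin cmp ^^ t) (initial_config M u)" for t
  from assms obtain t t' where t: "halted M (c t)" "word_at_head (snd (c t) ! 0) = y"
    and t': "halted M (c t')" "word_at_head (snd (c t') ! 0) = y'"
    unfolding outputs_within_def Let_def c_def by blast
  have later: "c s' = c s" if "s \<le> s'" "halted M (c s)" for s s'
  proof -
    have "c s' = (step M n lin cmp ^^ (s' - s)) (c s)"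
      using that(1) funpow_add[of "s' - s" s "step M n lin cmp"] by (simp add: c_def)
    then show ?thesis using halted_stays[OF that(2)] by simp
  qed
  have "c t = c t'"
    using later[of t t'] later[of t' t] t t' by (cases "t \<le> t'") auto
  then show ?thesis using t t' by simp
qed

text \<open>A machine learns about the linear-optimization oracle only through the answers to the words on
  its oracle tape. The words at states that make no query are included, which saves a case distinction
  and costs nothing in the count of steps.\<close>

lemma runs_agree:
  assumes "\<And>s. s < t \<Longrightarrow>
      (let u = word_at_head (snd ((step M n lin cmp ^^ s) c) ! 1)
       in lin_answer n lin' u = lin_answer n lin u)"
  shows "(step M n lin' cmp ^^ t) c = (step M n lin cmp ^^ t) c"
  using assms
proof (induction t)
  case (Suc t)
  obtain q ts where d: "(step M n lin cmp ^^ t) c = (q, ts)" by (cases "(step M n lin cmp ^^ t) c")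
  have "lin_answer n lin' (word_at_head (ts ! 1)) = lin_answer n lin (word_at_head (ts ! 1))"
    using Suc.prems[of t] d by (simp add: Let_def)
  moreover have "(step M n lin' cmp ^^ t) c = (step M n lin cmp ^^ t) c"
    using Suc by simp
  ultimately show ?case
    using d by (simp add: step_def[of _ _ _ _ "(q, ts)"] split: instr.split)
qed simp

text \<open>The adversary: each of the first \<open>T\<close> steps tells \<open>lin\<close> from at most one of the oracles \<open>lin' k\<close>,
  so more than \<open>T\<close> candidates leave one that none of these steps has exposed.\<close>

lemma indistinguishable_within:
  fixes K :: "'k set"
  assumes "finite K" and "T < card K"
    and unique: "\<And>v k k'. length v = n \<Longrightarrow> k \<in> K \<Longrightarrow> k' \<in> K \<Longrightarrow>
        lin' k v \<noteq> lin v \<Longrightarrow> lin' k' v \<noteq> lin v \<Longrightarrow> k = k'"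
  obtains k where "k \<in> K"
    "\<And>y. outputs_within M n lin cmp u T y \<Longrightarrow> outputs_within M n (lin' k) cmp u T y"
proof -
  define q where "q s = word_at_head (snd ((step M n lin cmp ^^ s) (initial_config M u)) ! 1)" for s
  define exposed where
    "exposed s = {k \<in> K. lin_answer n (lin' k) (q s) \<noteq> lin_answer n lin (q s)}" for s
  have "card (exposed s) \<le> 1" for s
  proof -
    have "k = k'" if "k \<in> exposed s" "k' \<in> exposed s" for k k'
    proof -
      from that have K: "k \<in> K" "k' \<in> K"
        and neq: "lin_answer n (lin' k) (q s) \<noteq> lin_answer n lin (q s)"
          "lin_answer n (lin' k') (q s) \<noteq> lin_answer n lin (q s)"
        by (auto simp: exposed_def)
      obtain v where v: "length v = n" "q s = enc_vec v"
        using neq(1) by (auto simp: lin_answer_def split: if_splits)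
      show "k = k'"
        using unique[OF v(1) K] neq lin_answer_enc_vec[OF v(1)] v(2) by metis
    qed
    moreover have "finite (exposed s)"
      using assms(1) by (simp add: exposed_def)
    ultimately show ?thesis by (simp add: card_le_Suc0_iff_eq)
  qed
  then have "card (\<Union>s<T. exposed s) \<le> T"
    using card_UN_le[of "{..<T}" exposed] sum_bounded_above[of "{..<T}" "\<lambda>s. card (exposed s)" 1]
    by simp
  then have "\<not> K \<subseteq> (\<Union>s<T. exposed s)"
    using assms(1,2) card_mono[of "\<Union>s<T. exposed s" K] by (fastforce simp: exposed_def)
  then obtain k where k: "k \<in> K" "\<And>s. s < T \<Longrightarrow> k \<notin> exposed s" by blast
  have "(step M n (lin' k) cmp ^^ t) (initial_config M u) = (step M n lin cmp ^^ t) (initial_config M u)"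
    if "t \<le> T" for t
    using k that by (intro runs_agree) (auto simp: exposed_def q_def)
  then have "outputs_within M n (lin' k) cmp u T y" if "outputs_within M n lin cmp u T y" for y
    using that unfolding outputs_within_def by auto
  with k(1) show thesis by (rule that)
qed

section \<open>Visible and hidden sets\<close>

text \<open>\<open>visible k a\<close> stays clear of sets with \<open>a\<close> elements in each half, although convex combinations of
  the two maximal patterns \<open>(a + 1, a - 1)\<close> and \<open>(a - 1, a + 1)\<close> reach \<open>(a, a)\<close>. That is why a linear
  objective hardly ever prefers a hidden set.\<close>

definition visible :: "nat \<Rightarrow> nat \<Rightarrow> nat set set" where
  "visible k a = {X. X \<subseteq> {..<2 * k} \<and>
     (card (X \<inter> {..<k}) \<le> a + 1 \<and> card (X \<inter> {k..<2 * k}) \<le> a - 1 \<or>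
      card (X \<inter> {..<k}) \<le> a - 1 \<and> card (X \<inter> {k..<2 * k}) \<le> a + 1)}"

definition hidden :: "nat \<Rightarrow> nat set \<Rightarrow> nat set" where
  "hidden k A = A \<union> (+) k ` A"

definition weights :: "nat \<Rightarrow> int list" where
  "weights k = replicate k 2 @ replicate k 3"

lemma hidden_subset: "A \<subseteq> {..<k} \<Longrightarrow> hidden k A \<subseteq> {..<2 * k}"
  by (auto simp: hidden_def)

lemma hidden_halves:
  assumes "A \<subseteq> {..<k}"
  shows "hidden k A \<inter> {..<k} = A" "hidden k A \<inter> {k..<2 * k} = (+) k ` A"
  using assms by (auto simp: hidden_def)

lemma visible_mono:
  assumes "X \<subseteq> Y" "Y \<in> visible k a"
  shows "X \<in> visible k a"
proof -
  have "card (X \<inter> {..<k}) \<le> card (Y \<inter> {..<k})" "card (X \<inter> {k..<2 * k}) \<le> card (Y \<inter> {k..<2 * k})"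
    using assms(1) by (auto intro!: card_mono)
  then show ?thesis
    using assms by (fastforce simp: visible_def)
qed

lemma independence_system_visible: "independence_system (2 * k) (indicator_vec (2 * k) ` visible k a)"
proof (rule independence_system_indicator_vecs)
  have "{} \<in> visible k a" by (simp add: visible_def)
  then show "visible k a \<noteq> {}" by blast
qed (use visible_mono in \<open>blast, auto simp: visible_def\<close>)

text \<open>Dropping any element of a hidden set leaves at most \<open>a - 1\<close> elements in one of the halves and at
  most \<open>a\<close> in the other.\<close>

lemma proper_subset_of_hidden_visible:
  assumes A: "A \<subseteq> {..<k}" "card A = a" and X: "X \<subset> hidden k A"
  shows "X \<in> visible k a"
proof -
  have fin: "finite A" using A(1) finite_subset by blast
  have cI: "card (X \<inter> {..<k}) \<le> a" and cJ: "card (X \<inter> {k..<2 * k}) \<le> a"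
  proof -
    have "X \<inter> {..<k} \<subseteq> A" "X \<inter> {k..<2 * k} \<subseteq> (+) k ` A"
      using X hidden_halves[OF A(1)] by blast+
    then have "card (X \<inter> {..<k}) \<le> card A" "card (X \<inter> {k..<2 * k}) \<le> card ((+) k ` A)"
      using fin by (simp_all add: card_mono)
    then show "card (X \<inter> {..<k}) \<le> a" "card (X \<inter> {k..<2 * k}) \<le> a"
      using A(2) by (simp_all add: card_image)
  qed
  obtain e where e: "e \<in> hidden k A" "e \<notin> X" using X by blast
  have "card (X \<inter> {..<k}) < a \<or> card (X \<inter> {k..<2 * k}) < a"
  proof (cases "e < k")
    case True
    then have "X \<inter> {..<k} \<subset> A"
      using X e hidden_halves[OF A(1)] by blast
    then show ?thesis using fin A(2) psubset_card_mono by blast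
  next
    case False
    then have "X \<inter> {k..<2 * k} \<subset> (+) k ` A"
      using X e hidden_halves[OF A(1)] hidden_subset[OF A(1)] by (auto simp: hidden_def)
    then have "card (X \<inter> {k..<2 * k}) < card ((+) k ` A)"
      using fin by (intro psubset_card_mono) auto
    then show ?thesis using A(2) by (simp add: card_image)
  qed
  moreover have "X \<subseteq> {..<2 * k}"
    using X hidden_subset[OF A(1)] by blast
  ultimately show ?thesis
    using cI cJ by (auto simp: visible_def)
qed

lemma independence_system_insert_hidden:
  assumes "A \<subseteq> {..<k}" "card A = a"
  shows "independence_system (2 * k)
    (insert (indicator_vec (2 * k) (hidden k A)) (indicator_vec (2 * k) ` visible k a))"
proof -
  have "independence_system (2 * k) (indicator_vec (2 * k) ` insert (hidden k A) (visible k a))"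
  proof (rule independence_system_indicator_vecs)
    show "X \<in> insert (hidden k A) (visible k a)"
      if "X \<subseteq> Y" "Y \<in> insert (hidden k A) (visible k a)" for X Y
    proof (cases "Y = hidden k A")
      case True
      then show ?thesis
        using that(1) proper_subset_of_hidden_visible[OF assms, of X] by (cases "X = Y") auto
    next
      case False
      then show ?thesis using that visible_mono[of X Y k a] by simp
    qed
  qed (use hidden_subset[OF assms(1)] in \<open>auto simp: visible_def\<close>)
  then show ?thesis by simp
qed

lemma dot_weights:
  assumes "X \<subseteq> {..<2 * k}"
  shows "dot (weights k) (indicator_vec (2 * k) X) =
    2 * int (card (X \<inter> {..<k})) + 3 * int (card (X \<inter> {k..<2 * k}))"
proof -
  have X: "X = (X \<inter> {..<k}) \<union> (X \<inter> {k..<2 * k})" using assms by auto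
  have "(\<Sum>j\<in>X. weights k ! j) =
      (\<Sum>j\<in>X \<inter> {..<k}. weights k ! j) + (\<Sum>j\<in>X \<inter> {k..<2 * k}. weights k ! j)"
    by (subst X, rule sum.union_disjoint) auto
  also have "(\<Sum>j\<in>X \<inter> {..<k}. weights k ! j) = (\<Sum>j\<in>X \<inter> {..<k}. 2)"
    by (rule sum.cong) (auto simp: weights_def nth_append)
  also have "(\<Sum>j\<in>X \<inter> {k..<2 * k}. weights k ! j) = (\<Sum>j\<in>X \<inter> {k..<2 * k}. 3)"
    by (rule sum.cong) (auto simp: weights_def nth_append)
  finally show ?thesis
    using assms by (simp add: dot_indicator_vec)
qed

lemma dot_weights_hidden:
  assumes "A \<subseteq> {..<k}" "card A = a"
  shows "dot (weights k) (indicator_vec (2 * k) (hidden k A)) = 5 * int a"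
  using dot_weights[OF hidden_subset[OF assms(1)]] hidden_halves[OF assms(1)] assms(2)
  by (simp add: card_image)

text \<open>The first pattern allows weight at most \<open>5 * a - 1\<close>. In the second, at most \<open>a\<close> elements of weight
  \<open>3\<close> allow at most \<open>5 * a - 2\<close>, and \<open>a + 1\<close> of them give a weight of the wrong parity.\<close>

lemma dot_weights_visible:
  assumes "X \<in> visible k a" "1 \<le> a"
  shows "dot (weights k) (indicator_vec (2 * k) X) \<noteq> 5 * int a"
proof -
  define i j where "i = card (X \<inter> {..<k})" and "j = card (X \<inter> {k..<2 * k})"
  have "dot (weights k) (indicator_vec (2 * k) X) = 2 * int i + 3 * int j"
    using assms(1) by (simp add: visible_def dot_weights i_def j_def)
  moreover have "2 * int i + 3 * int j \<noteq> 5 * int a"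
  proof -
    have "i \<le> a + 1 \<and> j \<le> a - 1 \<or> i \<le> a - 1 \<and> j \<le> a + 1"
      using assms(1) by (simp add: visible_def i_def j_def)
    then consider "i \<le> a + 1" "j + 1 \<le> a" | "i + 1 \<le> a" "j \<le> a" | "j = a + 1"
      using assms(2) by linarith
    then show ?thesis
    proof cases
      case 3
      have "2 * int i \<noteq> 2 * int a - 3" by presburger
      with 3 show ?thesis by auto
    qed linarith+
  qed
  ultimately show ?thesis by simp
qed

text \<open>Two exchanges in opposite directions: both yield visible sets, and together they contradict each
  other. This is the step that needs the part of a hidden set in the one half to determine the part
  in the other.\<close>

lemma at_most_one_hidden_beats_visible:
  assumes "1 \<le> a" and A: "A \<subseteq> {..<k}" "card A = a" and B: "B \<subseteq> {..<k}" "card B = a"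
    and beatsA: "\<And>X. X \<in> visible k a \<Longrightarrow> (\<Sum>j\<in>X. v j) < (\<Sum>j\<in>hidden k A. v j)"
    and beatsB: "\<And>X. X \<in> visible k a \<Longrightarrow> (\<Sum>j\<in>X. v j) < (\<Sum>j\<in>hidden k B. (v j :: int))"
  shows "A = B"
proof (rule ccontr)
  assume "A \<noteq> B"
  have fin: "finite A" "finite B" using A B finite_subset by blast+
  obtain i where i: "i \<in> A" "i \<notin> B"
    using \<open>A \<noteq> B\<close> A B fin card_subset_eq by (metis subsetI)
  obtain j where j: "j \<in> B" "j \<notin> A"
    using \<open>A \<noteq> B\<close> A B fin card_subset_eq by (metis subsetI)
  have ij: "i < k" "j < k" using i j A B by auto
  have finh: "finite (hidden k A)" "finite (hidden k B)"
    using fin by (auto simp: hidden_def)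
  \<comment> \<open>\<open>j \<notin> A\<close> makes \<open>k + j\<close> a new element of the hidden set of \<open>A\<close>; dually, \<open>i \<notin> B\<close> below.\<close>
  let ?X = "insert (k + j) (hidden k A - {i})"
  have "?X \<inter> {..<k} = A - {i}" "?X \<inter> {k..<2 * k} = insert (k + j) ((+) k ` A)"
    using hidden_halves[OF A(1)] ij by auto
  moreover have "card (A - {i}) = a - 1" "card (insert (k + j) ((+) k ` A)) = a + 1"
    using fin(1) i(1) j(2) A(2) by (simp_all add: card_image image_iff)
  moreover have "?X \<subseteq> {..<2 * k}"
    using hidden_subset[OF A(1)] ij by auto
  ultimately have "?X \<in> visible k a"
    by (simp add: visible_def)
  moreover have "(\<Sum>j\<in>?X. v j) = v (k + j) + ((\<Sum>j\<in>hidden k A. v j) - v i)"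
    using finh i j ij A by (subst sum.insert) (auto simp: sum_diff1 hidden_def)
  ultimately have 1: "v (k + j) < v i"
    using beatsA by fastforce
  let ?Y = "insert i (hidden k B - {k + j})"
  have "?Y \<inter> {..<k} = insert i B" "?Y \<inter> {k..<2 * k} = (+) k ` B - {k + j}"
    using hidden_halves[OF B(1)] ij by auto
  moreover have "card (insert i B) = a + 1" "card ((+) k ` B - {k + j}) = a - 1"
    using fin(2) i(2) j(1) B(2) by (simp_all add: card_image)
  moreover have "?Y \<subseteq> {..<2 * k}"
    using hidden_subset[OF B(1)] ij by auto
  ultimately have "?Y \<in> visible k a"
    by (simp add: visible_def)
  moreover have "(\<Sum>j\<in>?Y. v j) = v i + ((\<Sum>j\<in>hidden k B. v j) - v (k + j))"
    using finh i j ij B by (subst sum.insert) (auto simp: sum_diff1 hidden_def)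
  ultimately have "v i < v (k + j)"
    using beatsB by fastforce
  with 1 show False by simp
qed

section \<open>Polynomial time against exponentially many hidden sets\<close>

lemma length_enc_vec_weights: "length (enc_vec (weights k)) = 6 * k"
proof -
  have len: "length (enc_vec (replicate k z)) = length (enc_int z @ [Sep]) * k" for z
    by (induction k) (simp_all add: enc_vec_def)
  have "length (enc_vec (u @ v)) = length (enc_vec u) + length (enc_vec v)" for u v
    by (simp add: enc_vec_def)
  moreover have "length (enc_int 2) = 2" "length (enc_int 3) = 2"
    by (simp_all add: enc_int_def binary.simps[of 2] binary.simps[of 3] binary.simps[of "Suc 0"])
  ultimately show ?thesis by (simp add: weights_def len)
qed

lemma power2_le_central_binomial: "2 ^ m \<le> (2 * m) choose m"
proof (cases "m = 0")
  case False
  have "(of_nat (2 * m) / of_nat m :: real) ^ m \<le> of_nat ((2 * m) choose m)"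
    by (rule binomial_ge_n_over_k_pow_k) simp
  with False have "real (2 ^ m) \<le> real ((2 * m) choose m)" by simp
  then show ?thesis by (simp only: of_nat_le_iff)
qed simp

lemma ex_poly_less_power2:
  fixes p :: "nat poly"
  shows "\<exists>m\<ge>1. poly p (c * m) < 2 ^ m"
proof -
  define C where "C = (\<Sum>i\<le>degree p. coeff p i * c ^ i)"
  define d where "d = degree p"
  have bound: "poly p (c * m) \<le> C * m ^ d" if "1 \<le> m" for m
  proof -
    have "poly p (c * m) = (\<Sum>i\<le>d. coeff p i * c ^ i * m ^ i)"
      by (simp add: poly_altdef d_def power_mult_distrib mult.assoc)
    also have "\<dots> \<le> (\<Sum>i\<le>d. coeff p i * c ^ i * m ^ d)"
      using that by (intro sum_mono mult_left_mono power_increasing) auto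
    finally show ?thesis by (simp add: C_def d_def sum_distrib_right)
  qed
  \<comment> \<open>Powers of \<open>2\<close> are values of \<open>exp\<close> at multiples of \<open>ln 2\<close>.\<close>
  have "((\<lambda>m. (real m * ln 2) ^ d / exp (real m * ln 2)) \<longlonglongrightarrow> 0)"
    by (rule filterlim_compose[OF tendsto_power_div_exp_0])
       (intro filterlim_at_top_mult_tendsto_pos[OF tendsto_const] filterlim_real_sequentially, simp)
  then have "(\<lambda>m. real C / ln 2 ^ d * ((real m * ln 2) ^ d / exp (real m * ln 2))) \<longlonglongrightarrow> 0"
    by (rule tendsto_mult_right_zero)
  then have "(\<lambda>m. real C * real m ^ d / 2 ^ m) \<longlonglongrightarrow> 0"
    by (simp add: exp_of_nat_mult power_mult_distrib)
  then have "eventually (\<lambda>m. real C * real m ^ d / 2 ^ m < 1 \<and> 1 \<le> m) sequentially"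
    by (intro eventually_conj order_tendstoD(2) eventually_ge_at_top) auto
  then obtain m where m: "1 \<le> m" "real C * real m ^ d / 2 ^ m < 1"
    using eventually_happens trivial_limit_sequentially by blast
  then have "real (C * m ^ d) < real (2 ^ m)" by simp
  then have "C * m ^ d < 2 ^ m" by (simp only: of_nat_less_iff)
  then show ?thesis
    using bound[OF m(1)] m(1) by (meson le_less_trans)
qed

theorem theorem1p2:
  "\<not> (\<exists>(M :: oracle_machine) (p :: nat poly). well_formed M \<and>
        (\<forall>(n :: nat) (w :: int list) (S :: int list set) (f :: int \<Rightarrow> real)
            (lin :: int list \<Rightarrow> int list) (cmp :: int \<Rightarrow> int \<Rightarrow> bool).
           1 \<le> n \<and> length w = n \<and> set w \<subseteq> {2, 3} \<and>
           independence_system n S \<and>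
           linear_optimization_oracle n S lin \<and>
           comparison_oracle f cmp \<longrightarrow>
           (\<exists>x. optimal_solution S f w x \<and>
                outputs_within M n lin cmp (enc_vec w)
                  (poly p (length (enc_vec w))) (enc_vec x))))"
proof (rule notI, elim exE conjE)
  fix M :: oracle_machine and p :: "nat poly"
  assume solves: "\<forall>n w S f lin cmp.
      1 \<le> n \<and> length w = n \<and> set w \<subseteq> {2, 3} \<and> independence_system n S \<and>
      linear_optimization_oracle n S lin \<and> comparison_oracle f cmp \<longrightarrow>
      (\<exists>x. optimal_solution S f w x \<and>
        outputs_within M n lin cmp (enc_vec w) (poly p (length (enc_vec w))) (enc_vec x))"
  \<comment> \<open>With \<open>k = 2 * a\<close>, the encoded weight vector has length \<open>6 * k = 12 * a\<close>.\<close>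
  obtain a where a: "1 \<le> a" "poly p (12 * a) < 2 ^ a"
    using ex_poly_less_power2 by blast
  define k n w where "k = 2 * a" and "n = 2 * k" and "w = weights k"
  define K where "K = {A. A \<subseteq> {..<k} \<and> card A = a}"
  define S where "S = indicator_vec n ` visible k a"
  define hid where "hid A = indicator_vec n (hidden k A)" for A
  define f where "f z = (if z = 5 * int a then 0 else 1 :: real)" for z
  define cmp where "cmp y z \<longleftrightarrow> f y \<le> f z" for y z
  define T where "T = poly p (length (enc_vec w))"
  have w: "length w = n" "set w \<subseteq> {2, 3}"
    by (auto simp: w_def weights_def n_def)
  have n: "1 \<le> n" using a(1) by (simp add: n_def k_def)
  have cmp: "comparison_oracle f cmp"
    by (simp add: comparison_oracle_def cmp_def)
  have S: "independence_system n S"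
    by (simp add: S_def n_def independence_system_visible)
  obtain lin where lin: "linear_optimization_oracle n S lin"
    using ex_linear_optimization_oracle[OF S] by blast
  obtain x where x: "optimal_solution S f w x" "outputs_within M n lin cmp (enc_vec w) T (enc_vec x)"
    using solves n w S lin cmp unfolding T_def by blast

  have "card K = (2 * a) choose a"
    using n_subsets[of "{..<k}" a] by (simp add: K_def k_def)
  then have "T < card K"
    using a power2_le_central_binomial[of a]
    by (simp add: T_def w_def length_enc_vec_weights k_def)
  moreover have "finite K"
    by (rule finite_subset[of _ "Pow {..<k}"]) (auto simp: K_def)
  moreover have "A = B"
    if "length v = n" "A \<in> K" "B \<in> K"
      "prefer_old lin (hid A) v \<noteq> lin v" "prefer_old lin (hid B) v \<noteq> lin v" for v A B
  proof (rule at_most_one_hidden_beats_visible[of a])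
    have beats: "(\<Sum>j\<in>X. v ! j) < (\<Sum>j\<in>hidden k C. v ! j)"
      if "C \<in> K" "prefer_old lin (hid C) v \<noteq> lin v" "X \<in> visible k a" for C X
    proof -
      have "dot v (indicator_vec n X) \<le> dot v (lin v)"
        using lin that(3) \<open>length v = n\<close> by (auto simp: linear_optimization_oracle_def S_def)
      also have "\<dots> < dot v (hid C)"
        using that(2) by (simp add: prefer_old_def split: if_splits)
      finally show ?thesis
        using that hidden_subset[of C k]
        by (simp add: hid_def n_def dot_indicator_vec K_def visible_def)
    qed
    show "(\<Sum>j\<in>X. v ! j) < (\<Sum>j\<in>hidden k A. v ! j)" if "X \<in> visible k a" for X
      using beats that \<open>A \<in> K\<close> \<open>prefer_old lin (hid A) v \<noteq> lin v\<close> by blast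
    show "(\<Sum>j\<in>X. v ! j) < (\<Sum>j\<in>hidden k B. v ! j)" if "X \<in> visible k a" for X
      using beats that \<open>B \<in> K\<close> \<open>prefer_old lin (hid B) v \<noteq> lin v\<close> by blast
  qed (use that a in \<open>auto simp: K_def\<close>)
  ultimately obtain A where A: "A \<in> K"
    and same: "\<And>y. outputs_within M n lin cmp (enc_vec w) T y \<Longrightarrow>
      outputs_within M n (prefer_old lin (hid A)) cmp (enc_vec w) T y"
    using indistinguishable_within[of K T n "\<lambda>A. prefer_old lin (hid A)" lin M cmp "enc_vec w"]
    by blast

  have "independence_system n (insert (hid A) S)"
    using independence_system_insert_hidden[of A k a] A by (simp add: n_def hid_def S_def K_def)
  moreover have "linear_optimization_oracle n (insert (hid A) S) (prefer_old lin (hid A))"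
    using lin by (rule linear_optimization_oracle_insert)
  ultimately obtain x' where x': "optimal_solution (insert (hid A) S) f w x'"
      "outputs_within M n (prefer_old lin (hid A)) cmp (enc_vec w) T (enc_vec x')"
    using solves n w cmp unfolding T_def by blast
  have "enc_vec x = enc_vec x'"
    using outputs_within_unique same[OF x(2)] x'(2) by blast
  then have "x = x'" using inj_enc_vec by (simp add: inj_eq)
  then have "x \<in> S" "f (dot w x) \<le> f (dot w (hid A))"
    using x(1) x'(1) by (auto simp: optimal_solution_def)
  moreover have "dot w (hid A) = 5 * int a"
    using dot_weights_hidden A by (simp add: w_def hid_def n_def K_def)
  ultimately have "dot w x = 5 * int a"
    by (simp add: f_def split: if_splits)
  then show False
    using \<open>x \<in> S\<close> dot_weights_visible a(1) by (auto simp: S_def w_def n_def)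
qed

end
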